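(* Let $\ell>0$ and integers $m\ge n\ge 1$. Let $R=\{r_1,\ldots,r_n\}$ (riders) and $D=\{d_1,\ldots,d_m\}$ (drivers) be independent uniform random points on $[0,\ell]$ ($\ell$ may depend on $n,m$). Let $cost(OMN)$ denote the minimum, over all injective maps $\sigma:\{1,\ldots,n\}\to\{1,\ldots,m\}$, of $\sum_{i=1}^n |r_i-d_{\sigma(i)}|$. Then: (1) (Balanced market) There exists a constant $C>0$ such that for all $n\ge 1$, if $m=n$ then $\mathbb{E}[cost(OMN)]\ge C\ell\sqrt{n}$. (2) (Unbalanced market) For every $\epsilon>0$ there exists a constant $C_\epsilon>0$ such that for all $n\ge 4\epsilon^{-1}$ and all $m\ge(1+\epsilon)n$, $\mathbb{E}[cost(OMN)]\le C_\epsilon \ell$. The expectations are over the randomness of $R$ and $D$.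
   Context: $cost(OMN)$ is the cost of the "omniscient" matching: the value of the integer program minimizing $\sum_{i,j}x_{ij}|r_i-d_j|$ subject to every rider being matched to exactly one driver and every driver matched to at most one rider, $x_{ij}\in\{0,1\}$. The constants do not depend on $n$ or $\ell$. *)

theory Defs
  imports "HOL-Probability.Probability"
begin

definition matchings :: "nat \<Rightarrow> nat \<Rightarrow> (nat \<Rightarrow> nat) set" where
  "matchings n m = {\<sigma> \<in> {1..n} \<rightarrow>\<^sub>E {1..m}. inj_on \<sigma> {1..n}}"

text \<open>The minimum is over a finite set of values, which is nonempty exactly when \<open>n \<le> m\<close>.\<close>

definition cost_OMN :: "nat \<Rightarrow> nat \<Rightarrow> (nat \<Rightarrow> real) \<Rightarrow> (nat \<Rightarrow> real) \<Rightarrow> real" where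
  "cost_OMN n m r d = (MIN \<sigma>\<in>matchings n m. \<Sum>i=1..n. \<bar>r i - d (\<sigma> i)\<bar>)"

text \<open>
  The joint law of the \<open>n + m\<close> independent uniform points on \<open>[0, l]\<close>: the coordinate \<open>Inl i\<close> is
  rider \<open>i\<close>, the coordinate \<open>Inr j\<close> is driver \<open>j\<close>. Working with the law itself, rather than with
  random variables on an arbitrary probability space, keeps the constants of the theorem from
  depending on the type of the sample space; the lemma \<open>expectation_cost_OMN\<close> below transfers
  expectations to any such space.
\<close>

definition market :: "real \<Rightarrow> nat \<Rightarrow> nat \<Rightarrow> (nat + nat \<Rightarrow> real) measure" where
  "market l n m = (\<Pi>\<^sub>M k\<in>{1..n} <+> {1..m}. uniform_measure lborel {0..l})"

definition expected_cost_OMN :: "real \<Rightarrow> nat \<Rightarrow> nat \<Rightarrow> real" where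
  "expected_cost_OMN l n m =
     (\<integral>\<omega>. cost_OMN n m (\<lambda>i. \<omega> (Inl i)) (\<lambda>j. \<omega> (Inr j)) \<partial>market l n m)"

lemma finite_matchings: "finite (matchings n m)"
  unfolding matchings_def
  by (rule finite_subset[OF _ finite_PiE[of "{1..n}" "\<lambda>_. {1..m}"]]) auto

lemma matchings_nonempty:
  assumes "n \<le> m"
  shows "matchings n m \<noteq> {}"
proof -
  have "restrict id {1..n} \<in> matchings n m"
    using assms by (auto simp: matchings_def inj_on_def)
  thus ?thesis by blast
qed

lemma matchings_range: "\<sigma> \<in> matchings n m \<Longrightarrow> i \<in> {1..n} \<Longrightarrow> \<sigma> i \<in> {1..m}"
  by (auto simp: matchings_def)

lemma prob_space_uniform_Icc:
  assumes "0 < (l::real)"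
  shows "prob_space (uniform_measure lborel {0..l})"
  using assms by (intro prob_space_uniform_measure) auto

lemma prob_space_market:
  assumes "0 < l"
  shows "prob_space (market l n m)"
  unfolding market_def by (intro prob_space_PiM prob_space_uniform_Icc assms)

lemma measurable_cost_OMN:
  "(\<lambda>\<omega>. cost_OMN n m (\<lambda>i. \<omega> (Inl i)) (\<lambda>j. \<omega> (Inr j)))
     \<in> borel_measurable (\<Pi>\<^sub>M k\<in>{1..n} <+> {1..m}. (borel :: real measure))"
  unfolding cost_OMN_def
proof (rule borel_measurable_Min[OF finite_matchings])
  fix \<sigma> assume \<sigma>: "\<sigma> \<in> matchings n m"
  show "(\<lambda>\<omega>. \<Sum>i=1..n. \<bar>\<omega> (Inl i) - \<omega> (Inr (\<sigma> i))\<bar>)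
     \<in> borel_measurable (\<Pi>\<^sub>M k\<in>{1..n} <+> {1..m}. (borel :: real measure))"
    using matchings_range[OF \<sigma>]
    by (intro borel_measurable_sum borel_measurable_abs borel_measurable_diff
          measurable_component_singleton) auto
qed

lemma sets_market:
  "sets (market l n m) = sets (\<Pi>\<^sub>M k\<in>{1..n} <+> {1..m}. (borel :: real measure))"
  unfolding market_def by (intro sets_PiM_cong) auto

lemma cost_OMN_bounds:
  assumes "n \<le> m"
    and r: "\<And>i. i \<in> {1..n} \<Longrightarrow> r i \<in> {0..l}"
    and d: "\<And>j. j \<in> {1..m} \<Longrightarrow> d j \<in> {0..l}"
  shows "cost_OMN n m r d \<in> {0..n * l}"
proof -
  have "cost_OMN n m r d \<in> (\<lambda>\<sigma>. \<Sum>i=1..n. \<bar>r i - d (\<sigma> i)\<bar>) ` matchings n m"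
    unfolding cost_OMN_def
    using finite_matchings matchings_nonempty[OF assms(1)] by (intro Min_in) auto
  then obtain \<sigma> where \<sigma>: "\<sigma> \<in> matchings n m"
    and eq: "cost_OMN n m r d = (\<Sum>i=1..n. \<bar>r i - d (\<sigma> i)\<bar>)" by blast
  have "\<bar>r i - d (\<sigma> i)\<bar> \<le> l" if "i \<in> {1..n}" for i
    using r[OF that] d[OF matchings_range[OF \<sigma> that]] by auto
  hence "(\<Sum>i=1..n. \<bar>r i - d (\<sigma> i)\<bar>) \<le> (\<Sum>i=1..n. l)" by (intro sum_mono)
  thus ?thesis by (simp add: eq sum_nonneg)
qed

lemma integrable_cost_OMN:
  assumes "0 < l" "n \<le> m"
  shows "integrable (market l n m) (\<lambda>\<omega>. cost_OMN n m (\<lambda>i. \<omega> (Inl i)) (\<lambda>j. \<omega> (Inr j)))"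
proof -
  interpret prob_space "market l n m" by (rule prob_space_market[OF assms(1)])
  have "AE \<omega> in market l n m. \<omega> k \<in> {0..l}" if "k \<in> {1..n} <+> {1..m}" for k
    unfolding market_def
  proof (rule AE_PiM_component)
    show "AE x in uniform_measure lborel {0..l}. x \<in> {0..l}"
      using assms by (intro AE_uniform_measureI) auto
  qed (use that assms in \<open>auto intro!: prob_space_uniform_Icc\<close>)
  hence ae: "AE \<omega> in market l n m. \<forall>k\<in>{1..n} <+> {1..m}. \<omega> k \<in> {0..l}"
    by (intro AE_finite_allI) auto
  show ?thesis
  proof (rule integrable_const_bound[where B = "n * l"])
    show "AE \<omega> in market l n m.
            norm (cost_OMN n m (\<lambda>i. \<omega> (Inl i)) (\<lambda>j. \<omega> (Inr j))) \<le> n * l"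
      using ae
    proof eventually_elim
      case (elim \<omega>)
      have "cost_OMN n m (\<lambda>i. \<omega> (Inl i)) (\<lambda>j. \<omega> (Inr j)) \<in> {0..n * l}"
        using elim by (intro cost_OMN_bounds assms) auto
      thus ?case by auto
    qed
    show "(\<lambda>\<omega>. cost_OMN n m (\<lambda>i. \<omega> (Inl i)) (\<lambda>j. \<omega> (Inr j)))
            \<in> borel_measurable (market l n m)"
      using measurable_cost_OMN measurable_cong_sets[OF sets_market refl] by blast
  qed
qed

lemma (in prob_space) expectation_cost_OMN:
  fixes r d :: "nat \<Rightarrow> 'a \<Rightarrow> real"
  assumes "1 \<le> n"
    and indep: "indep_vars (\<lambda>_. borel) (case_sum r d) ({1..n} <+> {1..m})"
    and r: "\<And>i. i \<in> {1..n} \<Longrightarrow> distr M borel (r i) = uniform_measure lborel {0..l}"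
    and d: "\<And>j. j \<in> {1..m} \<Longrightarrow> distr M borel (d j) = uniform_measure lborel {0..l}"
  shows "expectation (\<lambda>\<omega>. cost_OMN n m (\<lambda>i. r i \<omega>) (\<lambda>j. d j \<omega>)) = expected_cost_OMN l n m"
proof -
  let ?I = "{1..n} <+> {1..m}"
  let ?X = "case_sum r d"
  let ?P = "\<Pi>\<^sub>M k\<in>?I. (borel :: real measure)"
  let ?f = "\<lambda>\<omega>. cost_OMN n m (\<lambda>i. \<omega> (Inl i)) (\<lambda>j. \<omega> (Inr j))"
  have rv: "random_variable borel (?X k)" if "k \<in> ?I" for k
    using indep that by (simp add: indep_vars_def)
  have "Inl 1 \<in> ?I" using assms(1) by auto
  hence ne: "?I \<noteq> {}" by blast
  have "distr M ?P (\<lambda>x. \<lambda>k\<in>?I. ?X k x) = (\<Pi>\<^sub>M k\<in>?I. distr M borel (?X k))"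
    using indep_vars_iff_distr_eq_PiM'[OF ne, where M' = "\<lambda>_. borel" and X = ?X] rv indep by blast
  also have "\<dots> = market l n m"
    unfolding market_def using r d by (intro PiM_cong) auto
  finally have law: "market l n m = distr M ?P (\<lambda>x. \<lambda>k\<in>?I. ?X k x)" by simp
  have "expected_cost_OMN l n m = expectation (\<lambda>x. ?f (\<lambda>k\<in>?I. ?X k x))"
    unfolding expected_cost_OMN_def law
    by (rule integral_distr[OF _ measurable_cost_OMN]) (intro measurable_restrict rv)
  also have "(\<lambda>x. ?f (\<lambda>k\<in>?I. ?X k x)) = (\<lambda>\<omega>. cost_OMN n m (\<lambda>i. r i \<omega>) (\<lambda>j. d j \<omega>))"
  proof
    fix x
    show "?f (\<lambda>k\<in>?I. ?X k x) = cost_OMN n m (\<lambda>i. r i x) (\<lambda>j. d j x)"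
      unfolding cost_OMN_def
      by (intro arg_cong[where f = Min] image_cong sum.cong refl)
         (use matchings_range in \<open>fastforce\<close>)
  qed
  finally show ?thesis by simp
qed

end

theory Submission
  imports Defs
begin

text \<open>
  Lower bound. For \<open>m = n\<close> a matching is a permutation, so its cost is at least \<open>\<bar>S\<bar>\<close> with
  \<open>S = (\<Sum>i. r i) - (\<Sum>j. d j)\<close>. Since \<open>\<bar>t S\<bar> \<ge> 1 - cos (t S)\<close> and, by independence, the
  expectation of \<open>cos (t S)\<close> is the \<open>2n\<close>-th power of the modulus of the characteristic function of a
  single point at \<open>t\<close>, the choice \<open>t = 1 / (l \<surd>n)\<close> gives an expected cost of order \<open>l \<surd>n\<close>.

  Upper bound. Cut \<open>[0, l)\<close> into \<open>n\<close> buckets of width \<open>l / n\<close> and scan them from left to right,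
  letting the drivers of a bucket serve riders who wait in a queue. A rider travels \<open>l / n\<close> per
  bucket spent in the queue, plus at most \<open>l / n\<close>; those left over at the end travel at most \<open>l\<close>. The
  queue length before bucket \<open>b\<close> is the excess of riders over drivers in the buckets from some \<open>a\<close> to
  \<open>b - 1\<close>. Drivers outnumber riders by the factor \<open>1 + \<epsilon>\<close>, so a Chernoff bound makes the
  contribution of each \<open>a\<close> exponentially small in \<open>b - a\<close>, and the expected queue length is bounded
  by a constant depending only on \<open>\<epsilon>\<close>.
\<close>

section \<open>Queue lengths and greedy matching\<close>

text \<open>\<open>queue R D b\<close> is the length just before bucket \<open>b\<close>. Truncated
  subtraction encodes that surplus drivers of a bucket are not kept for riders of later
  buckets.\<close>

primrec queue :: "(nat \<Rightarrow> nat) \<Rightarrow> (nat \<Rightarrow> nat) \<Rightarrow> nat \<Rightarrow> nat" where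
  "queue R D 0 = 0"
| "queue R D (Suc b) = queue R D b + R b - D b"

text \<open>The witness \<open>a\<close> is the last index up to \<open>b\<close> at which the queue
  is empty: it jumps to \<open>Suc b\<close> when the drivers suffice and is kept otherwise, where
  no truncation occurs.\<close>

lemma queue_eq_excess:
  "\<exists>a\<le>b. queue R D b + sum D {a..<b} = sum R {a..<b}"
proof (induction b)
  case 0
  show ?case by simp
next
  case (Suc b)
  then obtain a where a: "a \<le> b" "queue R D b + sum D {a..<b} = sum R {a..<b}" by blast
  show ?case
  proof (cases "queue R D b + R b \<le> D b")
    case True
    thus ?thesis by (intro exI[of _ "Suc b"]) simp
  next
    case False
    thus ?thesis using a by (intro exI[of _ a]) simp
  qed
qed

text \<open>The start \<open>a\<close> of the excess depends on the configuration, so all candidates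
  are summed; \<open>a = b\<close> contributes nothing, the queue being empty then. Bernoulli's
  inequality replaces the excess by a power of \<open>z\<close>, which factors over independent
  points.\<close>

lemma queue_le_sum_power:
  fixes z :: real
  assumes "1 < z"
  shows "real (queue R D b) \<le> (\<Sum>a<b. z ^ sum R {a..<b} * (1 / z) ^ sum D {a..<b} / (z - 1))"
proof -
  let ?t = "\<lambda>a. z ^ sum R {a..<b} * (1 / z) ^ sum D {a..<b} / (z - 1)"
  have nonneg: "0 \<le> ?t a" for a using assms by simp
  obtain a where a: "a \<le> b" "queue R D b + sum D {a..<b} = sum R {a..<b}"
    using queue_eq_excess by blast
  show ?thesis
  proof (cases "a = b")
    case True
    thus ?thesis using a nonneg by (simp add: sum_nonneg)
  next
    case False
    let ?q = "queue R D b"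
    have "1 + real ?q * (z - 1) \<le> (1 + (z - 1)) ^ ?q"
      using assms by (intro Bernoulli_inequality) simp
    hence "real ?q \<le> z ^ ?q / (z - 1)" using assms by (simp add: field_simps)
    also have "\<dots> = ?t a"
      using assms by (simp flip: a(2) add: power_add power_one_over)
    also have "\<dots> \<le> sum ?t {..<b}"
      using a(1) False nonneg by (intro member_le_sum) auto
    finally show ?thesis .
  qed
qed

text \<open>
  Greedy matching: in each bucket the new drivers serve as many of the waiting riders as they can.
  The weight \<open>b - \<beta> i\<close> of a rider still waiting is what \<open>\<delta> (\<sigma> i) - \<beta> i\<close> becomes if he is
  served in bucket \<open>b\<close>, so the total weight grows in each step by the new queue length.
\<close>

lemma ex_queue_matching:
  fixes I :: "'a set" and J :: "'b set" and \<beta> :: "'a \<Rightarrow> nat" and \<delta> :: "'b \<Rightarrow> nat"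
  assumes [simp]: "finite I" "finite J"
  defines "U \<equiv> queue (\<lambda>c. card {i\<in>I. \<beta> i = c}) (\<lambda>c. card {j\<in>J. \<delta> j = c})"
  shows "\<exists>A \<sigma>. A \<subseteq> {i\<in>I. \<beta> i < b} \<and> inj_on \<sigma> A \<and> \<sigma> ` A \<subseteq> {j\<in>J. \<delta> j < b} \<and>
     (\<forall>i\<in>A. \<beta> i \<le> \<delta> (\<sigma> i)) \<and> card ({i\<in>I. \<beta> i < b} - A) = U b \<and>
     (\<Sum>i\<in>A. \<delta> (\<sigma> i) - \<beta> i) + (\<Sum>i\<in>{i\<in>I. \<beta> i < b} - A. b - \<beta> i) = (\<Sum>c=1..b. U c)"
proof (induction b)
  case 0
  show ?case by (auto simp: U_def)
next
  case (Suc b)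
  let ?I = "\<lambda>b. {i\<in>I. \<beta> i < b}"
  obtain A \<sigma> where A: "A \<subseteq> ?I b" and inj: "inj_on \<sigma> A" and im: "\<sigma> ` A \<subseteq> {j\<in>J. \<delta> j < b}"
    and le: "\<forall>i\<in>A. \<beta> i \<le> \<delta> (\<sigma> i)" and cU: "card (?I b - A) = U b"
    and s: "(\<Sum>i\<in>A. \<delta> (\<sigma> i) - \<beta> i) + (\<Sum>i\<in>?I b - A. b - \<beta> i) = (\<Sum>c=1..b. U c)"
    using Suc.IH by blast
  define N where "N = {i\<in>I. \<beta> i = b}"
  define E where "E = {j\<in>J. \<delta> j = b}"
  define W where "W = (?I b - A) \<union> N"
  have fin [simp]: "finite A" "finite N" "finite E" "finite W"
    using A finite_subset[OF A] by (auto simp: N_def E_def W_def)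
  have cW: "card W = U b + card N"
    unfolding W_def cU[symmetric] by (rule card_Un_disjoint) (auto simp: N_def)
  have USuc: "U (Suc b) = card W - card E"
    by (simp add: cW U_def N_def E_def)
  \<comment> \<open>\<open>P\<close> holds the riders served in bucket \<open>b\<close>. With the
    minimum as its size, \<open>card W - card E\<close> riders stay behind, truncated exactly as in
    \<open>queue\<close>.\<close>
  obtain P where P: "P \<subseteq> W" "card P = min (card W) (card E)"
    using obtain_subset_with_card_n[of "min (card W) (card E)" W] by auto
  have [simp]: "finite P" using P(1) fin(4) by (rule finite_subset)
  obtain f where f: "f ` P \<subseteq> E" "inj_on f P"
    using card_le_inj[of P E] P by auto
  define \<sigma>' where "\<sigma>' = (\<lambda>i. if i \<in> P then f i else \<sigma> i)"
  have AP: "A \<inter> P = {}" using P A by (auto simp: W_def N_def)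
  have \<sigma>'A: "\<sigma>' i = \<sigma> i" if "i \<in> A" for i using AP that by (auto simp: \<sigma>'_def)
  have \<sigma>'P: "\<sigma>' i = f i" if "i \<in> P" for i using that by (auto simp: \<sigma>'_def)
  have rest: "?I (Suc b) - (A \<union> P) = W - P"
    using A by (auto simp: W_def N_def)
  have inj': "inj_on \<sigma>' (A \<union> P)"
  proof -
    have "inj_on \<sigma>' A" using inj \<sigma>'A by (simp cong: inj_on_cong)
    moreover have "inj_on \<sigma>' P" using f \<sigma>'P by (simp cong: inj_on_cong)
    moreover have "\<sigma>' ` A \<inter> \<sigma>' ` P = {}"
      using im f \<sigma>'A \<sigma>'P by (fastforce simp: E_def)
    ultimately show ?thesis by (auto simp: inj_on_Un)
  qed
  have cr: "card (W - P) = U (Suc b)"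
    using P by (simp add: card_Diff_subset USuc)
  have "(\<Sum>i\<in>A \<union> P. \<delta> (\<sigma>' i) - \<beta> i) = (\<Sum>i\<in>A. \<delta> (\<sigma> i) - \<beta> i) + (\<Sum>i\<in>P. b - \<beta> i)"
  proof -
    have "(\<Sum>i\<in>A \<union> P. \<delta> (\<sigma>' i) - \<beta> i) = (\<Sum>i\<in>A. \<delta> (\<sigma>' i) - \<beta> i) + (\<Sum>i\<in>P. \<delta> (\<sigma>' i) - \<beta> i)"
      using AP by (intro sum.union_disjoint) auto
    also have "(\<Sum>i\<in>A. \<delta> (\<sigma>' i) - \<beta> i) = (\<Sum>i\<in>A. \<delta> (\<sigma> i) - \<beta> i)"
      by (intro sum.cong) (auto simp: \<sigma>'A)
    also have "(\<Sum>i\<in>P. \<delta> (\<sigma>' i) - \<beta> i) = (\<Sum>i\<in>P. b - \<beta> i)"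
      using f by (intro sum.cong) (auto simp: \<sigma>'P E_def)
    finally show ?thesis .
  qed
  \<comment> \<open>Every rider in \<open>W\<close> has \<open>\<beta> i \<le> b\<close>, so no
    truncation occurs and each weight grows by exactly 1.\<close>
  moreover have "(\<Sum>i\<in>W - P. Suc b - \<beta> i) = (\<Sum>i\<in>W - P. b - \<beta> i) + U (Suc b)"
  proof -
    have "(\<Sum>i\<in>W - P. Suc b - \<beta> i) = (\<Sum>i\<in>W - P. (b - \<beta> i) + 1)"
      by (intro sum.cong) (auto simp: W_def N_def)
    thus ?thesis using cr by (simp add: sum.distrib del: Suc_eq_plus1 add_Suc_right One_nat_def)
  qed
  moreover have "(\<Sum>i\<in>P. b - \<beta> i) + (\<Sum>i\<in>W - P. b - \<beta> i) = (\<Sum>i\<in>W. b - \<beta> i)"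
    using P by (simp add: sum.subset_diff add.commute)
  \<comment> \<open>Riders arriving in bucket \<open>b\<close> enter with weight 0.\<close>
  moreover have "(\<Sum>i\<in>W. b - \<beta> i) = (\<Sum>i\<in>?I b - A. b - \<beta> i)"
    by (intro sum.mono_neutral_right) (auto simp: W_def N_def)
  ultimately have total: "(\<Sum>i\<in>A \<union> P. \<delta> (\<sigma>' i) - \<beta> i) + (\<Sum>i\<in>W - P. Suc b - \<beta> i)
      = (\<Sum>c=1..Suc b. U c)"
    using s by simp
  show ?case
  proof (intro exI[of _ "A \<union> P"] exI[of _ \<sigma>'] conjI)
    show "A \<union> P \<subseteq> ?I (Suc b)" using A P by (auto simp: W_def N_def)
    show "\<sigma>' ` (A \<union> P) \<subseteq> {j\<in>J. \<delta> j < Suc b}"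
      using im f by (fastforce simp: image_Un \<sigma>'A \<sigma>'P E_def)
    show "\<forall>i\<in>A \<union> P. \<beta> i \<le> \<delta> (\<sigma>' i)"
      using le f P by (fastforce simp: \<sigma>'A \<sigma>'P E_def W_def N_def)
  qed (use inj' rest cr total in simp_all)
qed

text \<open>Completes the greedy matching: \<open>\<sigma>\<close> occupies only
  \<open>card A\<close> elements of \<open>Y\<close>, which leaves enough free ones for
  \<open>X - A\<close>.\<close>

lemma ex_inj_on_extension:
  assumes "finite X" "finite Y" "card X \<le> card Y" "A \<subseteq> X" "inj_on \<sigma> A" "\<sigma> ` A \<subseteq> Y"
  shows "\<exists>\<tau>. inj_on \<tau> X \<and> \<tau> ` X \<subseteq> Y \<and> (\<forall>i\<in>A. \<tau> i = \<sigma> i)"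
proof -
  have "finite A" using assms(1,4) finite_subset by blast
  hence "card (X - A) \<le> card (Y - \<sigma> ` A)"
    using assms by (simp add: card_Diff_subset card_image)
  then obtain f where f: "f ` (X - A) \<subseteq> Y - \<sigma> ` A" "inj_on f (X - A)"
    using card_le_inj[of "X - A" "Y - \<sigma> ` A"] assms by auto
  let ?\<tau> = "\<lambda>i. if i \<in> A then \<sigma> i else f i"
  have "inj_on ?\<tau> (A \<union> (X - A))"
    using assms(5) f by (subst inj_on_Un) (auto simp: inj_on_def)
  hence "inj_on ?\<tau> X" using assms(4) by (simp add: Un_absorb1)
  moreover have "?\<tau> ` X \<subseteq> Y" using f assms by auto
  ultimately show ?thesis by (intro exI[of _ ?\<tau>]) auto
qed

section \<open>Buckets and the deterministic cost bound\<close>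

lemma cost_OMN_le:
  assumes "inj_on \<sigma> {1..n}" "\<sigma> ` {1..n} \<subseteq> {1..m}"
  shows "cost_OMN n m r d \<le> (\<Sum>i=1..n. \<bar>r i - d (\<sigma> i)\<bar>)"
proof -
  have "restrict \<sigma> {1..n} \<in> matchings n m"
    using assms by (auto simp: matchings_def inj_on_restrict_eq)
  hence "cost_OMN n m r d \<le> (\<Sum>i=1..n. \<bar>r i - d (restrict \<sigma> {1..n} i)\<bar>)"
    unfolding cost_OMN_def by (intro Min_le finite_imageI finite_matchings imageI)
  thus ?thesis by simp
qed

text \<open>Buckets are half-open and numbered from 0. The endpoint \<open>l\<close> would get
  number \<open>n\<close>, which is why points are later taken in \<open>{0..<l}\<close>.\<close>

definition bucket :: "real \<Rightarrow> nat \<Rightarrow> real \<Rightarrow> nat" where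
  "bucket l n x = nat \<lfloor>x * n / l\<rfloor>"

lemma bucket_in_iff:
  assumes "0 < l" "0 < n" "0 \<le> x"
  shows "bucket l n x \<in> {a..<b} \<longleftrightarrow> x \<in> {l / n * a..<l / n * b}"
proof -
  have "a \<le> bucket l n x \<longleftrightarrow> l / n * a \<le> x"
    using assms by (simp add: bucket_def le_nat_iff le_floor_iff field_simps)
  moreover have "bucket l n x < b \<longleftrightarrow> x < l / n * b"
    using assms by (simp add: bucket_def nat_less_iff floor_less_iff field_simps)
  ultimately show ?thesis by simp
qed

lemma bucket_bounds:
  assumes "0 < l" "0 < n" "0 \<le> x"
  shows "l / n * bucket l n x \<le> x" "x \<le> l / n * (bucket l n x + 1)"
  using bucket_in_iff[OF assms, of "bucket l n x" "bucket l n x + 1"] by simp_all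

text \<open>A served rider pays \<open>l / n\<close> per bucket waited plus at most
  \<open>l / n\<close> for the positions inside the buckets; the latter total at most
  \<open>l\<close>. The \<open>U n\<close> riders left over take arbitrary free drivers at cost at
  most \<open>l\<close> each.\<close>

lemma cost_OMN_le_queue:
  assumes nm: "1 \<le> n" "n \<le> m" "0 < l"
    and r: "\<And>i. i \<in> {1..n} \<Longrightarrow> r i \<in> {0..<l}"
    and d: "\<And>j. j \<in> {1..m} \<Longrightarrow> d j \<in> {0..<l}"
  defines "U \<equiv> queue (\<lambda>c. card {i\<in>{1..n}. bucket l n (r i) = c})
                    (\<lambda>c. card {j\<in>{1..m}. bucket l n (d j) = c})"
  shows "cost_OMN n m r d \<le> l / n * (\<Sum>c=1..n. real (U c)) + l + l * U n"
proof -
  let ?\<beta> = "\<lambda>i. bucket l n (r i)" and ?\<delta> = "\<lambda>j. bucket l n (d j)"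
  have lt: "?\<beta> i < n" if "i \<in> {1..n}" for i
    using bucket_in_iff[of l n "r i" 0 n] r[OF that] nm by simp
  hence all: "{i\<in>{1..n}. ?\<beta> i < n} = {1..n}" by blast
  obtain A \<sigma> where A: "A \<subseteq> {1..n}" and inj: "inj_on \<sigma> A" and im: "\<sigma> ` A \<subseteq> {1..m}"
    and le: "\<And>i. i \<in> A \<Longrightarrow> ?\<beta> i \<le> ?\<delta> (\<sigma> i)" and cU: "card ({1..n} - A) = U n"
    and s: "(\<Sum>i\<in>A. ?\<delta> (\<sigma> i) - ?\<beta> i) + (\<Sum>i\<in>{1..n} - A. n - ?\<beta> i) = (\<Sum>c=1..n. U c)"
    using ex_queue_matching[of "{1..n}" "{1..m}" ?\<beta> n ?\<delta>, unfolded all, folded U_def] by fast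
  obtain \<tau> where \<tau>: "inj_on \<tau> {1..n}" "\<tau> ` {1..n} \<subseteq> {1..m}" "\<And>i. i \<in> A \<Longrightarrow> \<tau> i = \<sigma> i"
    using ex_inj_on_extension[OF _ _ _ A inj im] nm by auto
  have "cost_OMN n m r d \<le> (\<Sum>i=1..n. \<bar>r i - d (\<tau> i)\<bar>)"
    by (rule cost_OMN_le[OF \<tau>(1,2)])
  also have "\<dots> = (\<Sum>i\<in>A. \<bar>r i - d (\<tau> i)\<bar>) + (\<Sum>i\<in>{1..n} - A. \<bar>r i - d (\<tau> i)\<bar>)"
    using A by (simp add: sum.subset_diff add.commute)
  also have "(\<Sum>i\<in>{1..n} - A. \<bar>r i - d (\<tau> i)\<bar>) \<le> (\<Sum>i\<in>{1..n} - A. l)"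
  proof (rule sum_mono)
    fix i assume "i \<in> {1..n} - A"
    hence "r i \<in> {0..<l}" "d (\<tau> i) \<in> {0..<l}" using \<tau>(2) r[of i] d[of "\<tau> i"] by blast+
    thus "\<bar>r i - d (\<tau> i)\<bar> \<le> l" by auto
  qed
  also have "\<dots> = l * U n" unfolding sum_constant cU by simp
  also have "(\<Sum>i\<in>A. \<bar>r i - d (\<tau> i)\<bar>) \<le> (\<Sum>i\<in>A. l / n * (real (?\<delta> (\<sigma> i) - ?\<beta> i) + 1))"
  proof (rule sum_mono)
    fix i assume i: "i \<in> A"
    have "0 \<le> r i" "0 \<le> d (\<sigma> i)" using i A im r[of i] d[of "\<sigma> i"] by auto
    note bd = bucket_bounds[OF nm(3) _ this(1), of n] bucket_bounds[OF nm(3) _ this(2), of n]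
    \<comment> \<open>This order of the buckets bounds both signs of the difference by the bucket
      distance plus one width.\<close>
    have "l / n * ?\<beta> i \<le> l / n * ?\<delta> (\<sigma> i)"
      using nm le[OF i] by (intro mult_left_mono) auto
    thus "\<bar>r i - d (\<tau> i)\<bar> \<le> l / n * (real (?\<delta> (\<sigma> i) - ?\<beta> i) + 1)"
      using bd nm by (simp add: \<tau>(3)[OF i] of_nat_diff[OF le[OF i]] distrib_left right_diff_distrib)
  qed
  also have "\<dots> = l / n * real (\<Sum>i\<in>A. ?\<delta> (\<sigma> i) - ?\<beta> i) + l / n * card A"
    by (simp add: sum_distrib_left sum.distrib distrib_left mult.commute)
  also have "\<dots> \<le> l / n * (\<Sum>c=1..n. real (U c)) + l / n * n"
  proof -
    \<comment> \<open>The weight of the riders left over is dropped from \<open>s\<close>.\<close>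
    have "real (\<Sum>i\<in>A. ?\<delta> (\<sigma> i) - ?\<beta> i) \<le> real (\<Sum>c=1..n. U c)"
      using s by linarith
    moreover have "card A \<le> n" using card_mono[OF _ A] by simp
    ultimately show ?thesis using nm by (intro add_mono mult_left_mono) auto
  qed
  finally show ?thesis using nm by simp
qed


section \<open>Integration over the random market\<close>

text \<open>Independence in product form. The field is general because the Chernoff bound uses real
  factors and the characteristic function complex ones.\<close>

lemma market_integral_prod:
  fixes f g :: "real \<Rightarrow> 'b::{real_normed_field,banach,second_countable_topology}"
  assumes "0 < l"
    and f: "integrable (uniform_measure lborel {0..l}) f"
    and g: "integrable (uniform_measure lborel {0..l}) g"
  shows "integrable (market l n m) (\<lambda>\<omega>. (\<Prod>i=1..n. f (\<omega> (Inl i))) * (\<Prod>j=1..m. g (\<omega> (Inr j))))"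
      (is ?int)
    and "(\<integral>\<omega>. (\<Prod>i=1..n. f (\<omega> (Inl i))) * (\<Prod>j=1..m. g (\<omega> (Inr j))) \<partial>market l n m) =
      (\<integral>x. f x \<partial>uniform_measure lborel {0..l}) ^ n *
      (\<integral>x. g x \<partial>uniform_measure lborel {0..l}) ^ m"
      (is ?eq)
proof -
  let ?M = "uniform_measure lborel {0..l}"
  let ?h = "case_sum (\<lambda>_. f) (\<lambda>_. g) :: nat + nat \<Rightarrow> real \<Rightarrow> 'b"
  interpret prob_space ?M by (rule prob_space_uniform_Icc[OF assms(1)])
  interpret product_sigma_finite "\<lambda>_ :: nat + nat. ?M" by standard
  have split: "(\<Prod>k\<in>{1..n} <+> {1..m}. H k) = (\<Prod>i=1..n. H (Inl i)) * (\<Prod>j=1..m. H (Inr j))"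
    for H :: "nat + nat \<Rightarrow> 'b"
    by (simp add: prod.Plus)
  have int: "integrable ?M (?h k)" if "k \<in> {1..n} <+> {1..m}" for k
    using f g by (cases k) auto
  show ?int
    using product_integrable_prod[of "{1..n} <+> {1..m}" ?h, OF _ int] unfolding market_def split by simp
  show ?eq
    using product_integral_prod[of "{1..n} <+> {1..m}" ?h, OF _ int] unfolding market_def split by simp
qed

lemma AE_market_in:
  assumes "0 < l"
  shows "AE \<omega> in market l n m. \<forall>k\<in>{1..n} <+> {1..m}. \<omega> k \<in> {0..<l}"
proof -
  have "AE \<omega> in market l n m. \<omega> k \<in> {0..<l}" if "k \<in> {1..n} <+> {1..m}" for k
    unfolding market_def
  proof (rule AE_PiM_component)
    show "AE x in uniform_measure lborel {0..l}. x \<in> {0..<l}"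
    proof (rule AE_uniform_measureI)
      show "AE x in lborel. x \<in> {0..l} \<longrightarrow> x \<in> {0..<l}"
        using AE_lborel_singleton[of l] by eventually_elim auto
    qed simp
  qed (use that assms in \<open>auto intro!: prob_space_uniform_Icc\<close>)
  thus ?thesis by (intro AE_finite_allI) auto
qed

text \<open>The integrand is \<open>z\<close> raised to the indicator of the interval, so this is
  one point's factor in the generating function of a count.\<close>

lemma integral_uniform_two_values:
  fixes z :: real
  assumes "0 < l" "0 \<le> a" "a \<le> b" "b \<le> l"
  shows "integrable (uniform_measure lborel {0..l}) (\<lambda>x. if x \<in> {a..<b} then z else 1)"
    and "(\<integral>x. (if x \<in> {a..<b} then z else 1) \<partial>uniform_measure lborel {0..l}) =
           1 + (b - a) / l * (z - 1)"
proof -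
  let ?M = "uniform_measure lborel {0..l}"
  interpret prob_space ?M by (rule prob_space_uniform_Icc[OF assms(1)])
  have eq: "(\<lambda>x. if x \<in> {a..<b} then z else 1) = (\<lambda>x. 1 + indicator {a..<b} x * (z - 1))"
    by (auto simp: indicator_def)
  have [measurable]: "{a..<b} \<in> sets ?M" by simp
  have int: "integrable ?M (\<lambda>x. indicator {a..<b} x * (z - 1))"
    by (intro integrable_mult_left integrable_real_indicator) (auto simp: emeasure_eq_measure)
  show "integrable ?M (\<lambda>x. if x \<in> {a..<b} then z else 1)"
    unfolding eq using int by simp
  have "{0..l} \<inter> {a..<b} = {a..<b}" using assms by auto
  hence "measure ?M {a..<b} = (b - a) / l"
    using assms by simp
  thus "(\<integral>x. (if x \<in> {a..<b} then z else 1) \<partial>?M) = 1 + (b - a) / l * (z - 1)"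
    unfolding eq using int prob_space by simp
qed

text \<open>Counts in consecutive buckets add up to the count in one interval, and a power of a
  count is a product over the points, as \<open>market_integral_prod\<close> requires.\<close>

lemma power_sum_bucket:
  fixes z :: real
  assumes "0 < l" "0 < n" "finite I" "\<And>i. i \<in> I \<Longrightarrow> 0 \<le> r i"
  shows "z ^ (\<Sum>c\<in>{a..<b}. card {i\<in>I. bucket l n (r i) = c}) =
         (\<Prod>i\<in>I. if r i \<in> {l / n * a..<l / n * b} then z else 1)"
proof -
  have "(\<Sum>c\<in>{a..<b}. card {i\<in>I. bucket l n (r i) = c}) =
      card (\<Union>c\<in>{a..<b}. {i\<in>I. bucket l n (r i) = c})"
    using assms by (intro card_UN_disjoint[symmetric]) auto
  also have "(\<Union>c\<in>{a..<b}. {i\<in>I. bucket l n (r i) = c}) = {i\<in>I. bucket l n (r i) \<in> {a..<b}}" by auto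
  also have "\<dots> = I \<inter> {i. r i \<in> {l / n * a..<l / n * b}}"
    using bucket_in_iff[of l n _ a b] assms by blast
  finally show ?thesis
    using assms(3) by (simp add: prod.If_cases)
qed

section \<open>Upper bound on the expected cost\<close>

text \<open>The midpoint \<open>z\<close> of 1 and \<open>1 + \<epsilon>\<close> makes the Chernoff
  exponent negative, so \<open>q < 1\<close>. A geometric series bounds each expected queue length
  by \<open>K\<close>; the constant adds 1 for positions inside buckets, \<open>K\<close> for
  waiting and \<open>K\<close> for riders left over.\<close>

lemma expected_cost_OMN_le:
  fixes \<epsilon> l :: real
  assumes "1 \<le> n" "n \<le> m" "0 < l" "0 < \<epsilon>" "(1 + \<epsilon>) * n \<le> m"
  defines "z \<equiv> 1 + \<epsilon> / 2"
  defines "q \<equiv> exp (- ((z - 1) * (1 + \<epsilon> - z) / z))"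
  shows "expected_cost_OMN l n m \<le> (1 + 2 * (1 / (z - 1) * (1 / (1 - q)))) * l"
proof -
  let ?M = "market l n m"
  interpret prob_space ?M by (rule prob_space_market) fact
  define w where "w = l / n"
  define T where "T = (\<lambda>a b \<omega>. (\<Prod>i=1..n. if \<omega> (Inl i) \<in> {w * real a..<w * real b} then z else 1) *
     (\<Prod>j=1..m. if \<omega> (Inr j) \<in> {w * real a..<w * real b} then 1 / z else 1) / (z - 1))"
  define K where "K = 1 / (z - 1) * (1 / (1 - q))"
  have z: "1 < z" "z < 1 + \<epsilon>" using assms by (auto simp: z_def)
  have q: "0 < q" "q < 1" using z by (auto simp: q_def)
  have w: "0 < w" "w * n = l" using assms by (auto simp: w_def)
  have T: "integrable ?M (T a b)" "expectation (T a b) \<le> q ^ (b - a) / (z - 1)"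
    if ab: "a \<le> b" "b \<le> n" for a b
  proof -
    let ?A = "{w * real a..<w * real b}"
    have 1: "0 \<le> w * a" "w * a \<le> w * b" "w * b \<le> l"
      using ab w mult_left_mono[of "real b" n w] by auto
    note I = integral_uniform_two_values[OF \<open>0 < l\<close> 1]
    note J = market_integral_prod[OF \<open>0 < l\<close> I(1)[of z] I(1)[of "1/z"], of n m]
    show "integrable ?M (T a b)"
      unfolding T_def using J(1) by simp
    \<comment> \<open>The probability that a point falls in buckets \<open>a\<close> to
      \<open>b - 1\<close>.\<close>
    define p where "p = (w * b - w * a) / l"
    have "0 \<le> w * b - w * a" "w * b - w * a \<le> l" using 1 by linarith+
    hence p: "0 \<le> p" "p \<le> 1" "p * n = real (b - a)"
      using assms(1,3) ab by (auto simp: p_def w_def field_simps of_nat_diff)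
    have "expectation (T a b) = (1 + p * (z - 1)) ^ n * (1 + p * (1 / z - 1)) ^ m / (z - 1)"
      unfolding T_def integral_divide_zero J(2) I(2) p_def ..
    also have "\<dots> \<le> q ^ (b - a) / (z - 1)"
    proof (intro divide_right_mono)
      have "(1 + p * (z - 1)) ^ n \<le> exp (p * (z - 1)) ^ n"
        using p z by (intro power_mono) auto
      \<comment> \<open>Raising the bound \<open>1 + y \<le> exp y\<close> to a power needs a
        nonnegative base, and here \<open>y\<close> is negative or 0.\<close>
      moreover have "p * (1 - 1 / z) \<le> 1 * 1" using p z by (intro mult_mono) auto
      hence nonneg: "0 \<le> 1 + p * (1 / z - 1)" by (simp add: algebra_simps)
      hence "(1 + p * (1 / z - 1)) ^ m \<le> exp (p * (1 / z - 1)) ^ m"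
        by (intro power_mono) auto
      ultimately have "(1 + p * (z - 1)) ^ n * (1 + p * (1 / z - 1)) ^ m
           \<le> exp (p * (z - 1)) ^ n * exp (p * (1 / z - 1)) ^ m"
        using nonneg by (intro mult_mono) auto
      also have "\<dots> = exp (p * n * (z - 1) - p * (1 - 1 / z) * m)"
        by (simp flip: exp_of_nat_mult exp_add add: algebra_simps)
      \<comment> \<open>The factor of \<open>m\<close> in the exponent is at most 0, so
        \<open>m\<close> may be replaced by its lower bound.\<close>
      also have "\<dots> \<le> exp (p * n * (z - 1) - p * (1 - 1 / z) * ((1 + \<epsilon>) * n))"
        using p z assms by (auto intro!: mult_left_mono)
      also have "p * n * (z - 1) - p * (1 - 1 / z) * ((1 + \<epsilon>) * n)
          = p * n * (- ((z - 1) * (1 + \<epsilon> - z) / z))"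
        using z by (simp add: field_simps)
      also have "exp \<dots> = q ^ (b - a)"
        unfolding p(3) q_def by (rule exp_of_nat_mult)
      finally show "(1 + p * (z - 1)) ^ n * (1 + p * (1 / z - 1)) ^ m \<le> q ^ (b - a)" .
    qed (use z in simp)
    finally show "expectation (T a b) \<le> q ^ (b - a) / (z - 1)" .
  qed
  have sumT: "expectation (\<lambda>\<omega>. \<Sum>a<b. T a b \<omega>) \<le> K" if b: "b \<le> n" for b
  proof -
    have "expectation (\<lambda>\<omega>. \<Sum>a<b. T a b \<omega>) = (\<Sum>a<b. expectation (T a b))"
      using b T(1) by (subst Bochner_Integration.integral_sum) auto
    also have "\<dots> \<le> (\<Sum>a<b. q ^ (b - a) / (z - 1))"
      using b T(2) by (intro sum_mono) auto
    \<comment> \<open>Lowering the exponent by one lets the reversed sum start at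
      \<open>q ^ 0\<close>.\<close>
    also have "\<dots> \<le> (\<Sum>a<b. q ^ (b - Suc a) / (z - 1))"
      using q z by (intro sum_mono divide_right_mono power_decreasing) auto
    also have "\<dots> = (\<Sum>a<b. q ^ a / (z - 1))"
      by (rule sum.nat_diff_reindex)
    also have "\<dots> = (1 - q ^ b) / (1 - q) / (z - 1)"
      using q by (simp add: sum_gp_strict flip: sum_divide_distrib)
    also have "\<dots> \<le> K"
      using q z by (simp add: K_def divide_right_mono mult.commute)
    finally show ?thesis .
  qed
  define V where "V = (\<lambda>b \<omega>. \<Sum>a<b. T a b \<omega>)"
  have V: "integrable ?M (V b)" "expectation (V b) \<le> K" if "b \<le> n" for b
    using sumT[OF that] T(1) that by (auto simp: V_def)
  have sumV: "integrable ?M (\<lambda>\<omega>. \<Sum>c=1..n. V c \<omega>)"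
    "expectation (\<lambda>\<omega>. \<Sum>c=1..n. V c \<omega>) = (\<Sum>c=1..n. expectation (V c))"
    using V(1) by (auto intro!: Bochner_Integration.integral_sum)
  have "expected_cost_OMN l n m \<le> expectation (\<lambda>\<omega>. w * (\<Sum>c=1..n. V c \<omega>) + l + l * V n \<omega>)"
    unfolding expected_cost_OMN_def
  proof (rule integral_mono_AE)
    show "integrable ?M (\<lambda>\<omega>. cost_OMN n m (\<lambda>i. \<omega> (Inl i)) (\<lambda>j. \<omega> (Inr j)))"
      using assms by (intro integrable_cost_OMN)
    show "integrable ?M (\<lambda>\<omega>. w * (\<Sum>c=1..n. V c \<omega>) + l + l * V n \<omega>)"
      using V(1) sumV(1) by simp
    show "AE \<omega> in ?M. cost_OMN n m (\<lambda>i. \<omega> (Inl i)) (\<lambda>j. \<omega> (Inr j))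
            \<le> w * (\<Sum>c=1..n. V c \<omega>) + l + l * V n \<omega>"
      using AE_market_in[OF \<open>0 < l\<close>]
    proof eventually_elim
      case (elim \<omega>)
      let ?r = "\<lambda>i. \<omega> (Inl i)" and ?d = "\<lambda>j. \<omega> (Inr j)"
      let ?U = "queue (\<lambda>c. card {i\<in>{1..n}. bucket l n (?r i) = c})
                      (\<lambda>c. card {j\<in>{1..m}. bucket l n (?d j) = c})"
      have r: "?r i \<in> {0..<l}" if "i \<in> {1..n}" for i using elim that by blast
      have d: "?d j \<in> {0..<l}" if "j \<in> {1..m}" for j using elim that by blast
      have UV: "real (?U b) \<le> V b \<omega>" for b
      proof -
        have "real (?U b) \<le> (\<Sum>a<b. z ^ (\<Sum>c\<in>{a..<b}. card {i\<in>{1..n}. bucket l n (?r i) = c}) *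
            (1 / z) ^ (\<Sum>c\<in>{a..<b}. card {j\<in>{1..m}. bucket l n (?d j) = c}) / (z - 1))"
          by (rule queue_le_sum_power[OF z(1)])
        also have "\<dots> = V b \<omega>"
          unfolding V_def T_def w_def
        proof (intro sum.cong refl arg_cong2[where f = "(/)"] arg_cong2[where f = "(*)"])
          fix a
          show "z ^ (\<Sum>c\<in>{a..<b}. card {i\<in>{1..n}. bucket l n (?r i) = c}) =
            (\<Prod>i=1..n. if ?r i \<in> {l / n * a..<l / n * b} then z else 1)"
            using r assms by (intro power_sum_bucket) auto
          show "(1 / z) ^ (\<Sum>c\<in>{a..<b}. card {j\<in>{1..m}. bucket l n (?d j) = c}) =
            (\<Prod>j=1..m. if ?d j \<in> {l / n * a..<l / n * b} then 1 / z else 1)"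
            using d assms by (intro power_sum_bucket) auto
        qed
        finally show ?thesis .
      qed
      have "cost_OMN n m ?r ?d \<le> w * (\<Sum>c=1..n. real (?U c)) + l + l * ?U n"
        unfolding w_def by (rule cost_OMN_le_queue[OF assms(1-3) r d])
      also have "\<dots> \<le> w * (\<Sum>c=1..n. V c \<omega>) + l + l * V n \<omega>"
        using w assms UV by (intro add_mono mult_left_mono sum_mono) auto
      finally show ?case .
    qed
  qed
  also have "\<dots> = w * (\<Sum>c=1..n. expectation (V c)) + l + l * expectation (V n)"
    using V(1) sumV prob_space by simp
  also have "\<dots> \<le> w * (\<Sum>c=1..n. K) + l + l * K"
    using w assms V(2) by (intro add_mono mult_left_mono sum_mono) auto
  also have "\<dots> = (1 + 2 * K) * l"
    using w by (simp add: algebra_simps)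
  finally show ?thesis by (simp add: K_def)
qed


section \<open>Lower bound in the balanced market\<close>

lemma abs_sum_diff_le_cost_OMN: "\<bar>(\<Sum>i=1..n. r i) - (\<Sum>j=1..n. d j)\<bar> \<le> cost_OMN n n r d"
proof -
  have "cost_OMN n n r d \<in> (\<lambda>\<sigma>. \<Sum>i=1..n. \<bar>r i - d (\<sigma> i)\<bar>) ` matchings n n"
    unfolding cost_OMN_def using finite_matchings matchings_nonempty[of n n] by (intro Min_in) auto
  then obtain \<sigma> where \<sigma>: "\<sigma> \<in> matchings n n"
    and eq: "cost_OMN n n r d = (\<Sum>i=1..n. \<bar>r i - d (\<sigma> i)\<bar>)" by blast
  have inj: "inj_on \<sigma> {1..n}" "\<sigma> ` {1..n} \<subseteq> {1..n}" using \<sigma> by (auto simp: matchings_def)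
  have "\<sigma> ` {1..n} = {1..n}" using endo_inj_surj[OF _ inj(2,1)] by simp
  hence "(\<Sum>j=1..n. d j) = (\<Sum>i=1..n. d (\<sigma> i))"
    using sum.reindex[OF inj(1), of d] by simp
  thus ?thesis by (simp add: eq flip: sum_subtractf)
qed

lemma one_minus_cos_le_abs: "1 - cos x \<le> \<bar>x\<bar>" for x :: real
proof -
  have "norm (cos x - cos 0) \<le> 1 * norm (x - 0)"
    by (rule field_differentiable_bound[where S = UNIV and f' = "\<lambda>x. - sin x"])
       (auto intro!: derivative_eq_intros)
  thus ?thesis by simp
qed

text \<open>Taylor expansion with the cosine in the remainder bounded below by -1. Order 6 is
  reached because the term in \<open>x^4\<close> supplies the decay of the characteristic
  function.\<close>

lemma cos_ge_degree6: "1 - x^2 / 2 + x^4 / 24 - x^6 / 720 \<le> cos x" for x :: real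
proof -
  obtain t where t: "cos x = (\<Sum>m<6. cos_coeff m * x ^ m) +
      (cos(t + 1/2 * real 6 * pi) / fact 6) * x ^ 6"
    using Maclaurin_cos_expansion[of x 6] by auto
  have "(\<Sum>m<6. cos_coeff m * x ^ m) = 1 - x^2 / 2 + x^4 / 24"
    by (simp add: cos_coeff_def lessThan_nat_numeral fact_numeral)
  moreover have "- 1 * x^6 \<le> cos(t + 1/2 * real 6 * pi) * x^6"
    by (intro mult_right_mono) auto
  ultimately show ?thesis using t by (simp add: fact_numeral)
qed

text \<open>The characteristic function of a uniform point, by the fundamental theorem of
  calculus.\<close>

lemma integral_uniform_exp:
  assumes "0 < l" "t \<noteq> 0"
  shows "integrable (uniform_measure lborel {0..l}) (\<lambda>x. exp (\<i> * complex_of_real (t * x)))"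
    and "(\<integral>x. exp (\<i> * complex_of_real (t * x)) \<partial>uniform_measure lborel {0..l}) =
           (exp (\<i> * complex_of_real (t * l)) - 1) / (\<i> * complex_of_real (t * l))"
proof -
  let ?M = "uniform_measure lborel {0..l}"
  let ?f = "\<lambda>x. exp (\<i> * complex_of_real (t * x))"
  let ?F = "\<lambda>x. exp (\<i> * complex_of_real (t * x)) / (\<i> * complex_of_real t)"
  interpret prob_space ?M by (rule prob_space_uniform_Icc[OF assms(1)])
  have meas [measurable]: "?f \<in> borel_measurable borel"
    by (intro borel_measurable_continuous_onI continuous_intros)
  have "norm (?f x) \<le> 1" for x by (simp add: norm_exp_i_times)
  thus "integrable ?M ?f"
    by (intro integrable_const_bound[where B = 1]) auto
  have M: "?M = density lborel (\<lambda>x. ennreal (indicator {0..l} x / l))"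
    using assms unfolding uniform_measure_def
    by (intro arg_cong[where f = "density lborel"] ext)
       (auto simp: indicator_def divide_ennreal simp flip: ennreal_1)
  have F: "(?F has_vector_derivative ?f x) (at x within {0..l})" for x
  proof -
    have "((\<lambda>z. exp (\<i> * complex_of_real t * z) / (\<i> * complex_of_real t)) has_field_derivative
            exp (\<i> * complex_of_real t * complex_of_real x)) (at (complex_of_real x))"
      using assms by (auto intro!: derivative_eq_intros)
    hence "((\<lambda>z. exp (\<i> * complex_of_real t * z) / (\<i> * complex_of_real t)) \<circ> complex_of_real
             has_vector_derivative exp (\<i> * complex_of_real t * complex_of_real x)) (at x within {0..l})"
      using has_vector_derivative_real_field has_vector_derivative_at_within
      by (fastforce simp: o_def)
    thus ?thesis by (simp add: o_def mult.assoc)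
  qed
  have "(\<integral>x. ?f x \<partial>?M) = (\<integral>x. (indicator {0..l} x / l) *\<^sub>R ?f x \<partial>lborel)"
    unfolding M using assms by (intro integral_density) auto
  also have "\<dots> = (\<integral>x. (1 / l) *\<^sub>R (indicator {0..l} x *\<^sub>R ?f x) \<partial>lborel)"
    by (intro Bochner_Integration.integral_cong) auto
  also have "\<dots> = (1 / l) *\<^sub>R (\<integral>x. indicator {0..l} x *\<^sub>R ?f x \<partial>lborel)"
    by (rule Bochner_Integration.integral_scaleR_right)
  also have "(\<integral>x. indicator {0..l} x *\<^sub>R ?f x \<partial>lborel) = ?F l - ?F 0"
    using assms F by (intro integral_FTC_Icc) (auto intro!: continuous_intros)
  also have "(1 / l) *\<^sub>R \<dots> = (?f l - 1) / (\<i> * complex_of_real (t * l))"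
    using assms by (simp add: scaleR_conv_of_real field_simps)
  finally show "(\<integral>x. ?f x \<partial>?M) = (?f l - 1) / (\<i> * complex_of_real (t * l))" .
qed

text \<open>The squared length of a chord of the unit circle.\<close>

lemma norm_exp_i_minus_1_squared: "(norm (exp (\<i> * complex_of_real x) - 1))\<^sup>2 = 2 - 2 * cos x"
proof -
  have "(cos x - 1)\<^sup>2 + (sin x)\<^sup>2 = 2 - 2 * cos x"
    using sin_cos_squared_add[of x] by (simp add: power2_eq_square algebra_simps)
  thus ?thesis by (simp add: cmod_power2 flip: cis_conv_exp)
qed

lemma expected_cost_OMN_ge:
  assumes "1 \<le> n" "0 < l"
  shows "(1 - exp (- 1 / 13)) * l * sqrt n \<le> expected_cost_OMN l n n"
proof -
  let ?M = "market l n n" and ?U = "uniform_measure lborel {0..l}"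
  interpret prob_space ?M by (rule prob_space_market) fact
  define x where "x = 1 / sqrt n"
  define t where "t = x / l"
  define S where "S = (\<lambda>\<omega> :: nat + nat \<Rightarrow> real. (\<Sum>i=1..n. \<omega> (Inl i)) - (\<Sum>j=1..n. \<omega> (Inr j)))"
  define e where "e = (\<lambda>s y. exp (\<i> * complex_of_real (s * y)))"
  define \<phi> where "\<phi> = (exp (\<i> * complex_of_real x) - 1) / (\<i> * complex_of_real x)"
  have x: "0 < x" "x \<le> 1" "x\<^sup>2 = 1 / n" using assms by (auto simp: x_def power_divide)
  have t: "0 < t" "t * l = x" using x assms by (auto simp: t_def)
  have int: "integrable ?U (e t)" "integrable ?U (e (- t))"
    using integral_uniform_exp(1)[OF assms(2), of t] integral_uniform_exp(1)[OF assms(2), of "- t"] t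
    by (auto simp: e_def)
  have \<phi>1: "(\<integral>y. e t y \<partial>?U) = \<phi>"
    using integral_uniform_exp(2)[OF assms(2), of t] t by (simp add: e_def \<phi>_def)
  \<comment> \<open>Drivers enter \<open>S\<close> with a minus sign, hence the conjugate; the two
    factors combine to the real number \<open>(norm \<phi>)\<^sup>2\<close>.\<close>
  have \<phi>2: "(\<integral>y. e (- t) y \<partial>?U) = cnj \<phi>"
  proof -
    have "(\<integral>y. e (- t) y \<partial>?U) = (\<integral>y. cnj (e t y) \<partial>?U)"
      by (simp add: e_def exp_cnj)
    also have "\<dots> = cnj (\<integral>y. e t y \<partial>?U)" by simp
    finally show ?thesis by (simp add: \<phi>1)
  qed
  have prod_eq: "(\<Prod>i=1..n. e t (\<omega> (Inl i))) * (\<Prod>j=1..n. e (- t) (\<omega> (Inr j))) = cis (t * S \<omega>)"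
    for \<omega> :: "nat + nat \<Rightarrow> real"
    by (simp add: e_def S_def cis_conv_exp algebra_simps sum_distrib_left sum_negf
        flip: exp_sum exp_add)
  note I = market_integral_prod[OF assms(2) int, of n n, unfolded prod_eq \<phi>1 \<phi>2]
  have cint: "integrable ?M (\<lambda>\<omega>. cos (t * S \<omega>))"
    using integrable_Re[OF I(1)] by simp
  have "expectation (\<lambda>\<omega>. cos (t * S \<omega>)) = Re (\<integral>\<omega>. cis (t * S \<omega>) \<partial>?M)"
    using integral_Re[OF I(1)] by simp
  also have "\<dots> = Re ((complex_of_real ((norm \<phi>)\<^sup>2)) ^ n)"
    by (simp only: I(2) complex_norm_square power_mult_distrib)
  also have "\<dots> = ((norm \<phi>)\<^sup>2) ^ n" by (metis Re_complex_of_real of_real_power)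
  also have "\<dots> \<le> exp (- 1 / 13)"
  proof -
    have "x^6 \<le> x^4" "0 \<le> x^4" using x(1,2) by (auto intro!: power_decreasing)
    \<comment> \<open>From \<open>x \<le> 1\<close>, the terms \<open>x^4 / 12 - x^6 / 360\<close>
      are at least \<open>29 / 360 * x^4\<close>, which exceeds \<open>x^4 / 13\<close>.\<close>
    hence "2 - 2 * cos x \<le> x^2 - x^4 / 13"
      using cos_ge_degree6[of x] by argo
    also have "\<dots> = x^2 * (1 - x^2 / 13)"
      by (simp add: algebra_simps flip: power_add)
    finally have "2 - 2 * cos x \<le> x^2 * (1 - x^2 / 13)" .
    hence "(norm \<phi>)\<^sup>2 \<le> 1 - x^2 / 13"
      using x(1) by (simp add: \<phi>_def norm_divide norm_mult power_divide norm_exp_i_minus_1_squared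
          divide_le_eq mult.commute)
    also have "\<dots> \<le> exp (- (x^2 / 13))" using exp_ge_add_one_self[of "- (x^2 / 13)"] by simp
    finally have "((norm \<phi>)\<^sup>2) ^ n \<le> exp (- (x^2 / 13)) ^ n" by (intro power_mono) auto
    \<comment> \<open>Since \<open>x\<^sup>2 = 1 / n\<close>, the \<open>n\<close>-th power cancels
      the dependence on \<open>n\<close>.\<close>
    also have "\<dots> = exp (- 1 / 13)"
      using assms x(3) by (simp flip: exp_of_nat_mult)
    finally show ?thesis .
  qed
  finally have c: "expectation (\<lambda>\<omega>. cos (t * S \<omega>)) \<le> exp (- 1 / 13)" .
  have "(1 - exp (- 1 / 13)) * l * sqrt n = (1 - exp (- 1 / 13)) / t"
    by (simp add: t_def x_def)
  also have "\<dots> \<le> (1 - expectation (\<lambda>\<omega>. cos (t * S \<omega>))) / t"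
    using c t by (intro divide_right_mono) auto
  also have "\<dots> = expectation (\<lambda>\<omega>. (1 - cos (t * S \<omega>)) / t)"
    using cint by (simp add: prob_space)
  also have "\<dots> \<le> expected_cost_OMN l n n"
    unfolding expected_cost_OMN_def
  proof (rule integral_mono)
    show "integrable ?M (\<lambda>\<omega>. (1 - cos (t * S \<omega>)) / t)" using cint by simp
    show "integrable ?M (\<lambda>\<omega>. cost_OMN n n (\<lambda>i. \<omega> (Inl i)) (\<lambda>j. \<omega> (Inr j)))"
      using assms by (intro integrable_cost_OMN) auto
    fix \<omega> :: "nat + nat \<Rightarrow> real"
    have "(1 - cos (t * S \<omega>)) / t \<le> \<bar>S \<omega>\<bar>"
      using one_minus_cos_le_abs[of "t * S \<omega>"] t by (simp add: abs_mult divide_le_eq mult.commute)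
    also have "\<dots> \<le> cost_OMN n n (\<lambda>i. \<omega> (Inl i)) (\<lambda>j. \<omega> (Inr j))"
      unfolding S_def by (rule abs_sum_diff_le_cost_OMN)
    finally show "(1 - cos (t * S \<omega>)) / t \<le> cost_OMN n n (\<lambda>i. \<omega> (Inl i)) (\<lambda>j. \<omega> (Inr j))" .
  qed
  finally show ?thesis .
qed

theorem theorem1:
  shows "(\<exists>C>0. \<forall>(n::nat) (m::nat) (l::real).
            1 \<le> n \<and> m = n \<and> 0 < l \<longrightarrow> expected_cost_OMN l n m \<ge> C * l * sqrt (real n))
       \<and> (\<forall>\<epsilon>::real. 0 < \<epsilon> \<longrightarrow>
            (\<exists>C>0. \<forall>(n::nat) (m::nat) (l::real).
               1 \<le> n \<and> n \<le> m \<and> 0 < l \<and> real n \<ge> 4 / \<epsilon> \<and> real m \<ge> (1 + \<epsilon>) * real n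
                 \<longrightarrow> expected_cost_OMN l n m \<le> C * l))"
proof (intro conjI allI impI)
  show "\<exists>C>0. \<forall>(n::nat) (m::nat) (l::real).
            1 \<le> n \<and> m = n \<and> 0 < l \<longrightarrow> expected_cost_OMN l n m \<ge> C * l * sqrt (real n)"
    using expected_cost_OMN_ge by (intro exI[of _ "1 - exp (- 1 / 13)"]) auto
next
  fix \<epsilon> :: real
  assume \<epsilon>: "0 < \<epsilon>"
  define z where "z = 1 + \<epsilon> / 2"
  define q where "q = exp (- ((z - 1) * (1 + \<epsilon> - z) / z))"
  \<comment> \<open>The constant of \<open>expected_cost_OMN_le\<close>; it depends on \<epsilon>
    alone and is fixed before \<open>n\<close>, \<open>m\<close> and \<open>l\<close>.\<close>
  define C where "C = 1 + 2 * (1 / (z - 1) * (1 / (1 - q)))"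
  have "0 < (z - 1) * (1 + \<epsilon> - z) / z" using \<epsilon> by (auto simp: z_def)
  hence "q < 1" by (simp add: q_def)
  hence "0 < C" using \<epsilon> by (auto simp: C_def z_def intro!: add_pos_nonneg)
  moreover have "expected_cost_OMN l n m \<le> C * l"
    if "1 \<le> n \<and> n \<le> m \<and> 0 < l \<and> real n \<ge> 4 / \<epsilon> \<and> real m \<ge> (1 + \<epsilon>) * real n" for n m l
    using expected_cost_OMN_le[of n m l \<epsilon>] that \<epsilon> by (simp add: C_def q_def z_def)
  ultimately show "\<exists>C>0. \<forall>(n::nat) (m::nat) (l::real).
      1 \<le> n \<and> n \<le> m \<and> 0 < l \<and> real n \<ge> 4 / \<epsilon> \<and> real m \<ge> (1 + \<epsilon>) * real n
        \<longrightarrow> expected_cost_OMN l n m \<le> C * l"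
    by blast
qed

end
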